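(* There exists an instance of the TSP-mD with a single drone ($m=1$), all-zero payloads ($w_i=0$ for all $i$) and Euclidean metrics $\ell,\ell'$ such that all the optimal solutions are arc-retraversing.
   Context: Instance. An instance of the TSP-mD (Traveling Salesman Problem with Drones) consists of a finite set $N$ of nodes with a depot $0\in N$; the complete directed graph with arc set $A=\{(i,j)\in N\times N: i\neq j\}$; subsets $N^{tr},N^{dr}\subseteq N$ (nodes that can be served by the truck, resp. by the drones) with $N^{tr}\cup N^{dr}=N$ and $0\in N^{tr}$; two metrics $\ell,\ell'$ on $N$ ($\ell_{ij}$, resp. $\ell'_{ij}$, is the time the truck, resp. a drone, needs to traverse $(i,j)$); a number $m\ge 1$ of identical drones; a drone weight $w^{dr}>0$; payloads $w_i\ge 0$ for $i\in N^{dr}$; and a battery capacity $B>0$. Sorties. A sortie is a tuple $\pi=(i_1,\dots,i_r)$, $r\ge 3$, with $i_1,i_r\in N^{tr}$, $i_2,\dots,i_{r-1}\in N^{dr}$ and consecutive nodes distinct ($i_1=i_r$ is allowed). It serves the nodes $N[\pi]=\{i_2,\dots,i_{r-1}\}$ and has duration $\ell'_\pi=\sum_{q=1}^{r-1}\ell'_{i_qi_{q+1}}$. Its energy consumption is $w^{dr}\sum_{q=1}^{r-1}\ell'_{i_qi_{q+1}}+\sum_{p=2}^{r-1}\bigl(w_{i_p}\sum_{q=1}^{p-1}\ell'_{i_qi_{q+1}}\bigr)$, and it is feasible if this is at most $B$. Solutions. A (feasible) solution consists of a truck route, which is a closed walk $0=v_0,v_1,\dots,v_n=0$ with all $v_t\in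 N^{tr}$ and consecutive nodes distinct (nodes and arcs may be repeated), and a finite family of feasible sorties, each assigned to a drone and to a pair of visit indices $s\le e$ such that the sortie starts at $v_s$ (launch from the truck at its visit number $s$) and ends at $v_e$ (retrieval by the truck at visit number $e$). The sorties of the same drone are performed one after the other (each one is launched at or after the visit at which the previous one was retrieved, and after that retrieval). Every node of $N$ must be on the truck route or served by some sortie. The truck starts at time $0$; it may wait at nodes, a drone may wait at its landing node for the truck, a sortie with duration $\ell'_\pi$ launched while the truck is at visit $s$ lands $\ell'_\pi$ time units after launch, and the truck may not leave visit $e$ before the drone has landed. Launching, retrieving, serving and battery swapping take no time. The completion time is the earliest time at which the truck has completed its route and all drones have been retrieved at the depot or earlier; it is to be minimized over all solutions, and a solution is optimal if it attains the minimum. Only instances admitting at least one feasible solution are considered. A solution is arc-retraversing if its truck route traverses some arc $(i,j)\in A$ (in the direction from $i$ to $j$) more than once. "Euclidean metrics" means that the nodes are points of a Euclidean space and that $\ell$ and $\ell'$ are (positive multiples of) Euclidean distances. *)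

theory Defs
  imports "HOL-Analysis.Analysis"
begin

section \<open>Instances\<close>

text \<open>Nodes are natural numbers and the depot is the node 0; since node sets are finite, this is
  only a choice of names. The values of the two time functions and of the payloads matter on
  the relevant nodes only.\<close>

record tsp_md =
  nodes :: "nat set"
  truck_nodes :: "nat set"
  drone_nodes :: "nat set"
  truck_time :: "nat \<Rightarrow> nat \<Rightarrow> real"
  drone_time :: "nat \<Rightarrow> nat \<Rightarrow> real"
  num_drones :: nat
  drone_weight :: real
  payload :: "nat \<Rightarrow> real"
  battery :: real

definition tsp_md_instance :: "tsp_md \<Rightarrow> bool" where
  "tsp_md_instance I \<longleftrightarrow>
     finite (nodes I) \<and> truck_nodes I \<union> drone_nodes I = nodes I \<and> 0 \<in> truck_nodes I \<and>
     Metric_space (nodes I) (truck_time I) \<and> Metric_space (nodes I) (drone_time I) \<and>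
     1 \<le> num_drones I \<and> 0 < drone_weight I \<and> (\<forall>i\<in>drone_nodes I. 0 \<le> payload I i) \<and>
     0 < battery I"

text \<open>The nodes are points of a Euclidean space whose dimension \<open>n\<close> is existentially
  quantified, so points are coordinate functions on \<open>{..<n}\<close> rather than elements of a type of
  fixed dimension. Both metrics are multiples of the distances of the same points.\<close>

definition euclidean_metrics :: "tsp_md \<Rightarrow> bool" where
  "euclidean_metrics I \<longleftrightarrow>
     (\<exists>(n::nat) (p :: nat \<Rightarrow> nat \<Rightarrow> real) c c'. 0 < c \<and> 0 < c' \<and>
        (\<forall>i\<in>nodes I. \<forall>j\<in>nodes I.
           truck_time I i j = c * L2_set (\<lambda>k. p i k - p j k) {..<n} \<and>
           drone_time I i j = c' * L2_set (\<lambda>k. p i k - p j k) {..<n}))"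

section \<open>Sorties\<close>

text \<open>List positions start at 0, so the position \<open>p\<close> below is the index \<open>p + 1\<close> of
  the tuple \<open>(i\<^sub>1,\<dots>,i\<^sub>r)\<close>.\<close>

definition served :: "nat list \<Rightarrow> nat set" where
  "served \<pi> = set (butlast (tl \<pi>))"

definition sortie :: "tsp_md \<Rightarrow> nat list \<Rightarrow> bool" where
  "sortie I \<pi> \<longleftrightarrow> 3 \<le> length \<pi> \<and> hd \<pi> \<in> truck_nodes I \<and> last \<pi> \<in> truck_nodes I \<and>
     served \<pi> \<subseteq> drone_nodes I \<and> distinct_adj \<pi>"

definition duration :: "tsp_md \<Rightarrow> nat list \<Rightarrow> real" where
  "duration I \<pi> = (\<Sum>q<length \<pi> - 1. drone_time I (\<pi> ! q) (\<pi> ! Suc q))"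

definition energy :: "tsp_md \<Rightarrow> nat list \<Rightarrow> real" where
  "energy I \<pi> =
     drone_weight I * (\<Sum>q<length \<pi> - 1. drone_time I (\<pi> ! q) (\<pi> ! Suc q)) +
     (\<Sum>p\<in>{1..<length \<pi> - 1}.
        payload I (\<pi> ! p) * (\<Sum>q<p. drone_time I (\<pi> ! q) (\<pi> ! Suc q)))"

definition feasible_sortie :: "tsp_md \<Rightarrow> nat list \<Rightarrow> bool" where
  "feasible_sortie I \<pi> \<longleftrightarrow> sortie I \<pi> \<and> energy I \<pi> \<le> battery I"

section \<open>Solutions\<close>

text \<open>The visit indices are positions in the truck route \<open>v\<^sub>0,\<dots>,v\<^sub>n\<close>, a list of length
  \<open>n + 1\<close>. The missions of drone \<open>d < num_drones I\<close> are listed in the order in which that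
  drone performs them.\<close>

record mission =
  flight :: "nat list"
  launch_visit :: nat
  retrieval_visit :: nat

record solution =
  route :: "nat list"
  missions :: "nat \<Rightarrow> mission list"

definition truck_route :: "tsp_md \<Rightarrow> nat list \<Rightarrow> bool" where
  "truck_route I v \<longleftrightarrow> v \<noteq> [] \<and> hd v = 0 \<and> last v = 0 \<and> set v \<subseteq> truck_nodes I \<and> distinct_adj v"

definition feasible_solution :: "tsp_md \<Rightarrow> solution \<Rightarrow> bool" where
  "feasible_solution I S \<longleftrightarrow>
     truck_route I (route S) \<and>
     (\<forall>d<num_drones I. \<forall>x\<in>set (missions S d).
        feasible_sortie I (flight x) \<and>
        launch_visit x \<le> retrieval_visit x \<and> retrieval_visit x < length (route S) \<and>
        hd (flight x) = route S ! launch_visit x \<and>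
        last (flight x) = route S ! retrieval_visit x) \<and>
     (\<forall>d<num_drones I. \<forall>k. Suc k < length (missions S d) \<longrightarrow>
        retrieval_visit (missions S d ! k) \<le> launch_visit (missions S d ! Suc k)) \<and>
     nodes I \<subseteq> set (route S) \<union> (\<Union>d<num_drones I. \<Union>x\<in>set (missions S d). served (flight x))"

section \<open>Completion time\<close>

text \<open>A schedule gives the truck's arrival and departure time at each visit, and the launch
  and retrieval time of mission number \<open>k\<close> of drone \<open>d\<close>. A retrieval may be later than the
  landing, since the drone may have to wait for the truck.\<close>

record schedule =
  arrival :: "nat \<Rightarrow> real"
  departure :: "nat \<Rightarrow> real"
  launch_time :: "nat \<Rightarrow> nat \<Rightarrow> real"
  retrieval_time :: "nat \<Rightarrow> nat \<Rightarrow> real"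

definition valid_schedule :: "tsp_md \<Rightarrow> solution \<Rightarrow> schedule \<Rightarrow> bool" where
  "valid_schedule I S \<sigma> \<longleftrightarrow>
     arrival \<sigma> 0 = 0 \<and>
     (\<forall>t<length (route S). arrival \<sigma> t \<le> departure \<sigma> t) \<and>
     (\<forall>t. Suc t < length (route S) \<longrightarrow>
        arrival \<sigma> (Suc t) = departure \<sigma> t + truck_time I (route S ! t) (route S ! Suc t)) \<and>
     (\<forall>d<num_drones I. \<forall>k<length (missions S d).
        let x = missions S d ! k in
        arrival \<sigma> (launch_visit x) \<le> launch_time \<sigma> d k \<and>
        launch_time \<sigma> d k \<le> departure \<sigma> (launch_visit x) \<and>
        launch_time \<sigma> d k + duration I (flight x) \<le> retrieval_time \<sigma> d k \<and>
        arrival \<sigma> (retrieval_visit x) \<le> retrieval_time \<sigma> d k \<and>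
        retrieval_time \<sigma> d k \<le> departure \<sigma> (retrieval_visit x)) \<and>
     (\<forall>d<num_drones I. \<forall>k. Suc k < length (missions S d) \<longrightarrow>
        retrieval_time \<sigma> d k \<le> launch_time \<sigma> d (Suc k))"

definition completed_by :: "tsp_md \<Rightarrow> solution \<Rightarrow> schedule \<Rightarrow> real \<Rightarrow> bool" where
  "completed_by I S \<sigma> T \<longleftrightarrow>
     arrival \<sigma> (length (route S) - 1) \<le> T \<and>
     (\<forall>d<num_drones I. \<forall>k<length (missions S d). retrieval_time \<sigma> d k \<le> T)"

text \<open>The infimum is attained for feasible solutions: the constraints are lower bounds of one
  time by another one plus a constant, without cyclic dependencies, so that there is a least
  schedule.\<close>

definition completion_time :: "tsp_md \<Rightarrow> solution \<Rightarrow> real" where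
  "completion_time I S = Inf {T. \<exists>\<sigma>. valid_schedule I S \<sigma> \<and> completed_by I S \<sigma> T}"

definition optimal_solution :: "tsp_md \<Rightarrow> solution \<Rightarrow> bool" where
  "optimal_solution I S \<longleftrightarrow> is_arg_min (completion_time I) (feasible_solution I) S"

definition arc_retraversing :: "solution \<Rightarrow> bool" where
  "arc_retraversing S \<longleftrightarrow>
     (\<exists>s t. s < t \<and> Suc t < length (route S) \<and>
        route S ! s = route S ! t \<and> route S ! Suc s = route S ! Suc t)"

end

theory Submission
  imports Defs
begin

text \<open>The truck may use only the depot \<open>0\<close> and the node \<open>1\<close>, at distance 10 from each other, and it
  is much faster than the drone, which has to serve three pairs of nodes. A pair lies between
  \<open>0\<close> and \<open>1\<close>, its first node closer to \<open>0\<close> and its second one closer to \<open>1\<close>. The battery allows to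
  serve a pair in one sortie only by crossing from one truck node to the other, and it does not
  allow to mix pairs. Three crossings suffice, but they need a truck route such as
  \<open>0, 1, 0, 1, 0\<close>. Without arc repetition the truck route is \<open>0\<close> or \<open>0, 1, 0\<close>, so that there are at
  most two crossings and hence at least four sorties, which take longer.\<close>

section \<open>Schedules\<close>

lemma truck_time_nonneg: "tsp_md_instance I \<Longrightarrow> 0 \<le> truck_time I i j"
  by (auto simp: tsp_md_instance_def intro: Metric_space.nonneg)

lemma duration_nonneg: "tsp_md_instance I \<Longrightarrow> 0 \<le> duration I \<pi>"
  by (auto simp: duration_def tsp_md_instance_def intro!: sum_nonneg intro: Metric_space.nonneg)

text \<open>At every visit the truck waits for the total duration \<open>W\<close> of all missions, so that mission
  \<open>k\<close> can be launched when as much time has passed since the arrival at its launch visit as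
  the earlier missions of its drone take together.\<close>

lemma ex_valid_schedule:
  assumes inst: "tsp_md_instance I" and feas: "feasible_solution I S"
  shows "\<exists>\<sigma> T. valid_schedule I S \<sigma> \<and> completed_by I S \<sigma> T"
proof -
  define D where "D d k = (\<Sum>j<k. duration I (flight (missions S d ! j)))" for d k
  define W where "W = (\<Sum>d<num_drones I. D d (length (missions S d)))"
  define \<tau> where "\<tau> t = real t * W + (\<Sum>u<t. truck_time I (route S ! u) (route S ! Suc u))" for t
  define \<sigma> where "\<sigma> = \<lparr>arrival = \<tau>, departure = (\<lambda>t. \<tau> t + W),
      launch_time = (\<lambda>d k. \<tau> (launch_visit (missions S d ! k)) + D d k),
      retrieval_time = (\<lambda>d k. \<tau> (retrieval_visit (missions S d ! k)) + D d (Suc k))\<rparr>"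
  have D_nonneg: "0 \<le> D d k" for d k
    unfolding D_def by (intro sum_nonneg duration_nonneg[OF inst])
  have D_mono: "D d j \<le> D d k" if "j \<le> k" for d j k
    unfolding D_def using that by (intro sum_mono2) (auto intro: duration_nonneg[OF inst])
  have D_W: "D d k \<le> W" if "d < num_drones I" "k \<le> length (missions S d)" for d k
  proof -
    have "D d (length (missions S d)) \<le> W"
      unfolding W_def using that D_nonneg by (intro member_le_sum) auto
    then show ?thesis
      using D_mono[OF that(2)] by (meson order_trans)
  qed
  have W_nonneg: "0 \<le> W"
    unfolding W_def by (intro sum_nonneg D_nonneg)
  have \<tau>_mono: "\<tau> s \<le> \<tau> t" if "s \<le> t" for s t
    unfolding \<tau>_def using that W_nonneg truck_time_nonneg[OF inst]
    by (intro add_mono mult_right_mono sum_mono2) auto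
  have \<tau>_Suc: "\<tau> (Suc t) = \<tau> t + W + truck_time I (route S ! t) (route S ! Suc t)" for t
    by (simp add: \<tau>_def algebra_simps)
  have D_Suc: "D d (Suc k) = D d k + duration I (flight (missions S d ! k))" for d k
    by (simp add: D_def)
  have le: "launch_visit (missions S d ! k) \<le> retrieval_visit (missions S d ! k)"
    "retrieval_visit (missions S d ! k) < length (route S)"
    if "d < num_drones I" "k < length (missions S d)" for d k
    using feas that by (auto simp: feasible_solution_def)
  have seq: "retrieval_visit (missions S d ! k) \<le> launch_visit (missions S d ! Suc k)"
    if "d < num_drones I" "Suc k < length (missions S d)" for d k
    using feas that by (auto simp: feasible_solution_def)
  \<comment> \<open>Mission \<open>k\<close> is retrieved and mission \<open>Suc k\<close> launched
    with the same offset \<open>D d (Suc k)\<close>, so \<open>seq\<close> and monotonicity of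
    \<open>\<tau>\<close> order them; offsets never exceed \<open>W\<close>, the time the truck
    waits.\<close>
  have "valid_schedule I S \<sigma>"
    unfolding valid_schedule_def Let_def
    using W_nonneg D_nonneg D_W \<tau>_mono[OF le(1)] \<tau>_mono[OF seq]
    by (auto simp: \<sigma>_def \<tau>_Suc D_Suc[symmetric]) (auto simp: \<tau>_def D_Suc)
  moreover have "completed_by I S \<sigma> (\<tau> (length (route S) - 1) + W)"
    unfolding completed_by_def \<sigma>_def
    using W_nonneg D_W \<tau>_mono[of _ "length (route S) - 1"] le(2)
    by (fastforce intro!: add_mono)
  ultimately show ?thesis
    by blast
qed

text \<open>No launch precedes time 0, and the missions of one drone do not overlap, so their
  durations add up to at most its last retrieval time.\<close>

lemma sum_duration_le:
  assumes inst: "tsp_md_instance I" and feas: "feasible_solution I S"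
    and val: "valid_schedule I S \<sigma>" and T: "completed_by I S \<sigma> T" and d: "d < num_drones I"
  shows "(\<Sum>k<length (missions S d). duration I (flight (missions S d ! k))) \<le> T"
proof -
  have arr: "0 \<le> arrival \<sigma> t" if "t < length (route S)" for t
    using that
  proof (induction t)
    case 0
    then show ?case using val by (simp add: valid_schedule_def)
  next
    case (Suc t)
    then have "arrival \<sigma> (Suc t) = departure \<sigma> t + truck_time I (route S ! t) (route S ! Suc t)"
      "arrival \<sigma> t \<le> departure \<sigma> t"
      using val by (auto simp: valid_schedule_def)
    then show ?case using Suc truck_time_nonneg[OF inst, of "route S ! t" "route S ! Suc t"] by simp
  qed
  have flight: "launch_time \<sigma> d k + duration I (flight (missions S d ! k)) \<le> retrieval_time \<sigma> d k"
    if "k < length (missions S d)" for k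
    using val that d by (auto simp: valid_schedule_def Let_def)
  have sum_le: "(\<Sum>j\<le>k. duration I (flight (missions S d ! j))) \<le> retrieval_time \<sigma> d k"
    if "k < length (missions S d)" for k
    using that
  proof (induction k)
    case 0
    then have "missions S d ! 0 \<in> set (missions S d)" by simp
    then have "launch_visit (missions S d ! 0) < length (route S)"
      using feas d by (fastforce simp: feasible_solution_def)
    moreover have "arrival \<sigma> (launch_visit (missions S d ! 0)) \<le> launch_time \<sigma> d 0"
      using val 0 d by (auto simp: valid_schedule_def Let_def)
    ultimately show ?case using flight[OF 0] arr by fastforce
  next
    case (Suc k)
    have "retrieval_time \<sigma> d k \<le> launch_time \<sigma> d (Suc k)"
      using val Suc.prems d by (auto simp: valid_schedule_def)
    then show ?case using Suc flight[OF Suc.prems] by simp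
  qed
  show ?thesis
  proof (cases "length (missions S d)")
    case 0
    have "route S \<noteq> []"
      using feas by (simp add: feasible_solution_def truck_route_def)
    then have "0 \<le> arrival \<sigma> (length (route S) - 1)"
      by (intro arr) simp
    then show ?thesis using 0 T by (simp add: completed_by_def)
  next
    case (Suc n)
    then have "retrieval_time \<sigma> d n \<le> T"
      using T d by (simp add: completed_by_def)
    then show ?thesis
      using sum_le[of n] Suc by (simp add: lessThan_Suc_atMost)
  qed
qed

text \<open>\<open>Inf\<close> is below its members only for a set that is bounded below; the
  flights of a single drone provide the bound 0.\<close>

lemma completion_time_le:
  assumes "tsp_md_instance I" "feasible_solution I S" "valid_schedule I S \<sigma>" "completed_by I S \<sigma> T"
  shows "completion_time I S \<le> T"
proof -
  have "0 < num_drones I"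
    using assms(1) by (simp add: tsp_md_instance_def)
  then have "0 \<le> T'" if "valid_schedule I S \<sigma>'" "completed_by I S \<sigma>' T'" for \<sigma>' T'
    using sum_duration_le[OF assms(1,2) that] duration_nonneg[OF assms(1)]
    by (meson order_trans sum_nonneg)
  then have "bdd_below {T. \<exists>\<sigma>. valid_schedule I S \<sigma> \<and> completed_by I S \<sigma> T}"
    by (intro bdd_belowI[of _ 0]) auto
  then show ?thesis
    unfolding completion_time_def using assms by (intro cInf_lower) auto
qed

text \<open>A lower bound passes to \<open>Inf\<close> only for a nonempty set, hence the appeal to
  \<open>ex_valid_schedule\<close>.\<close>

lemma sum_duration_le_completion_time:
  assumes "tsp_md_instance I" "feasible_solution I S" "d < num_drones I"
  shows "(\<Sum>k<length (missions S d). duration I (flight (missions S d ! k))) \<le> completion_time I S"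
  unfolding completion_time_def
  using ex_valid_schedule[OF assms(1,2)] sum_duration_le[OF assms(1,2) _ _ assms(3)]
  by (intro cInf_greatest) auto

section \<open>The instance\<close>

text \<open>The pairs are \<open>2 * k\<close>, \<open>2 * k + 1\<close> for \<open>k = 1, 2, 3\<close>, and the pair \<open>k\<close> has the offset 3 from the
  line through \<open>0\<close> and \<open>1\<close> in the direction of coordinate \<open>k\<close>.\<close>

definition pos :: "nat \<Rightarrow> nat \<Rightarrow> real" where
  "pos x k =
     (if k = 0 then if x = 0 then 0 else if x = 1 then 10 else if even x then 4 else 6
      else if x div 2 = k then 3 else 0)"

definition pos_dist :: "nat \<Rightarrow> nat \<Rightarrow> real" where
  "pos_dist x y = L2_set (\<lambda>k. pos x k - pos y k) {..<4}"

text \<open>With weight 1 and no payloads, energy equals duration. The battery 12 is exactly the 5 +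
  2 + 5 of a crossing through one pair; the truck crosses in 1.\<close>

definition pair_instance :: tsp_md where
  "pair_instance = \<lparr>nodes = {..<8}, truck_nodes = {0, 1}, drone_nodes = {2..<8},
     truck_time = (\<lambda>x y. pos_dist x y / 10), drone_time = pos_dist, num_drones = 1,
     drone_weight = 1, payload = (\<lambda>_. 0), battery = 12\<rparr>"

lemma pos_dist_eq:
  "pos_dist x y = sqrt ((pos x 0 - pos y 0)\<^sup>2 + (pos x 1 - pos y 1)\<^sup>2 +
     (pos x 2 - pos y 2)\<^sup>2 + (pos x 3 - pos y 3)\<^sup>2)"
  by (simp add: pos_dist_def L2_set_def eval_nat_numeral)

text \<open>After a case split over the nodes, the premise is a numerical inequality free of square
  roots.\<close>

lemma pos_dist_geI:
  "r\<^sup>2 \<le> (pos x 0 - pos y 0)\<^sup>2 + (pos x 1 - pos y 1)\<^sup>2 + (pos x 2 - pos y 2)\<^sup>2 +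
     (pos x 3 - pos y 3)\<^sup>2 \<Longrightarrow> r \<le> pos_dist x y"
  unfolding pos_dist_eq by (rule real_le_rsqrt)

lemma nat_less_8: "x < 8 \<longleftrightarrow> x \<in> {0, 1, 2, 3, 4, 5, 6, 7 :: nat}"
  by auto

lemma Metric_space_pos_dist: "Metric_space {..<8} pos_dist"
proof
  show "0 \<le> pos_dist x y" for x y
    by (simp add: pos_dist_def)
  show "pos_dist x y = pos_dist y x" for x y
    by (simp add: pos_dist_eq power2_commute)
  show "pos_dist x y = 0 \<longleftrightarrow> x = y" if "x \<in> {..<8}" "y \<in> {..<8}" for x y
  proof
    assume "pos_dist x y = 0"
    then have eq: "pos x k = pos y k" if "k < 4" for k
      using that by (simp add: pos_dist_def L2_set_eq_0_iff)
    show "x = y"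
      using that eq[of 0] eq[of 1] eq[of 2] eq[of 3] unfolding lessThan_iff nat_less_8
      by (elim insertE emptyE; hypsubst; simp add: pos_def)
  qed (simp add: pos_dist_def L2_set_eq_0_iff)
  show "pos_dist x z \<le> pos_dist x y + pos_dist y z" for x y z
    using L2_set_triangle_ineq[of "\<lambda>k. pos x k - pos y k" "\<lambda>k. pos y k - pos z k" "{..<4}"]
    by (simp add: pos_dist_def)
qed

lemma pos_dist_commute: "pos_dist x y = pos_dist y x"
  by (rule Metric_space.commute[OF Metric_space_pos_dist])

lemma pair_instance: "tsp_md_instance pair_instance"
proof -
  have "Metric_space {..<8} (\<lambda>x y. pos_dist x y / 10)"
    using Metric_space_pos_dist unfolding Metric_space_def by (simp add: field_simps)
  then show ?thesis
    using Metric_space_pos_dist by (auto simp: tsp_md_instance_def pair_instance_def)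
qed

lemma euclidean_pair_instance: "euclidean_metrics pair_instance"
  unfolding euclidean_metrics_def
  by (rule exI[of _ 4], rule exI[of _ pos], rule exI[of _ "1/10"], rule exI[of _ 1])
    (simp add: pair_instance_def pos_dist_def)

section \<open>Distance bounds that limit what one battery can serve\<close>

lemma drone_nodes_less_8: "x \<in> {2..<8} \<longleftrightarrow> x \<in> {2, 3, 4, 5, 6, 7 :: nat}"
  by auto

lemma pos_dist_truck_node:
  assumes "h \<in> {0, 1}" "x \<in> {2..<8}"
  shows "5 \<le> pos_dist h x" "5 \<le> pos_dist x h"
proof -
  show "5 \<le> pos_dist h x"
    using assms unfolding drone_nodes_less_8
    by (intro pos_dist_geI) (elim insertE emptyE; hypsubst; simp add: pos_def)
  then show "5 \<le> pos_dist x h"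
    by (simp add: pos_dist_commute)
qed

text \<open>Different pairs are offset by 3 in orthogonal directions, so the squared distance is at
  least 18. With two outer legs of at least 5, mixing pairs costs 14 > 12.\<close>

lemma pos_dist_other_pair:
  assumes "x \<in> {2..<8}" "y \<in> {2..<8}" "x div 2 \<noteq> y div 2"
  shows "4 \<le> pos_dist x y"
  using assms unfolding drone_nodes_less_8
  by (intro pos_dist_geI) (elim insertE emptyE; hypsubst; simp add: pos_def)

lemma pos_dist_same_pair:
  assumes "h \<in> {0, 1}" "x \<in> {2..<8}" "y \<in> {2..<8}" "x \<noteq> y" "x div 2 = y div 2"
  shows "13 \<le> pos_dist h x + pos_dist x y + pos_dist y h"
proof -
  have "2 \<le> pos_dist x y"
    using assms(2-5) unfolding drone_nodes_less_8
    by (intro pos_dist_geI) (elim insertE emptyE; hypsubst; simp add: pos_def)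
  moreover have "11 \<le> pos_dist h x + pos_dist y h"
  proof -
    \<comment> \<open>Even nodes are the ones near 0, odd nodes the ones near 1; the far node of a
      pair has distance \<open>sqrt 45\<close> from \<open>h\<close>.\<close>
    have far: "6 \<le> pos_dist h z" if "z \<in> {2..<8}" "even z \<longleftrightarrow> h = 1" for z
      using assms(1) that unfolding drone_nodes_less_8
      by (intro pos_dist_geI) (elim insertE emptyE; hypsubst; simp add: pos_def)
    have "even x \<noteq> even y"
      using assms(4,5) by presburger
    then have "6 \<le> pos_dist h x \<or> 6 \<le> pos_dist h y"
      using far assms(2,3) by metis
    then show ?thesis
      using pos_dist_truck_node(1)[OF assms(1,2)] pos_dist_truck_node(2)[OF assms(1,3)]
      by (auto simp: pos_dist_commute[of h y])
  qed
  ultimately show ?thesis by simp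
qed

section \<open>Sorties of the instance\<close>

lemma metric_path_le:
  fixes d :: "'a \<Rightarrow> 'a \<Rightarrow> real"
  assumes "Metric_space M d" "set xs \<subseteq> M" "i \<le> j" "j < length xs"
  shows "d (xs ! i) (xs ! j) \<le> (\<Sum>q\<in>{i..<j}. d (xs ! q) (xs ! Suc q))"
  using assms(3,4)
proof (induction j rule: dec_induct)
  case base
  then show ?case
    using assms by (simp add: Metric_space.mdist_zero subset_iff)
next
  case (step n)
  have "d (xs ! i) (xs ! Suc n) \<le> d (xs ! i) (xs ! n) + d (xs ! n) (xs ! Suc n)"
    using step assms by (intro Metric_space.triangle[OF assms(1)]) (auto simp: subset_iff)
  then show ?case
    using step by simp
qed

lemma sortie_nodes:
  assumes "tsp_md_instance I" "sortie I \<pi>"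
  shows "set \<pi> \<subseteq> nodes I"
proof -
  have "\<pi> = hd \<pi> # butlast (tl \<pi>) @ [last \<pi>]"
    using assms(2) by (cases \<pi>) (auto simp: sortie_def)
  then have "set \<pi> = insert (hd \<pi>) (insert (last \<pi>) (served \<pi>))"
    by (metis Un_insert_right empty_set list.simps(15) served_def set_append sup_bot_right)
  then show ?thesis
    using assms by (auto simp: sortie_def tsp_md_instance_def)
qed

lemma served_nth:
  assumes "x \<in> served \<pi>"
  obtains i where "0 < i" "Suc i < length \<pi>" "\<pi> ! i = x"
proof -
  obtain j where "j < length \<pi> - 2" "butlast (tl \<pi>) ! j = x"
    using assms by (auto simp: served_def in_set_conv_nth numeral_2_eq_2)
  then show ?thesis
    by (intro that[of "Suc j"]) (auto simp: nth_butlast nth_tl)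
qed

lemma nth_mem_served:
  assumes "0 < i" "Suc i < length \<pi>"
  shows "\<pi> ! i \<in> served \<pi>"
proof -
  have "butlast (tl \<pi>) ! (i - 1) = \<pi> ! i" "i - 1 < length (butlast (tl \<pi>))"
    using assms by (auto simp: nth_butlast nth_tl)
  then show ?thesis
    unfolding served_def by (metis nth_mem)
qed

text \<open>The triangle inequality shortcuts a sortie of any length to two of its stops;
  \<open>i = j\<close> gives the bound for a single stop.\<close>

lemma duration_ge_via:
  assumes "sortie pair_instance \<pi>" "i \<le> j" "j < length \<pi>"
  shows "pos_dist (hd \<pi>) (\<pi> ! i) + pos_dist (\<pi> ! i) (\<pi> ! j) + pos_dist (\<pi> ! j) (last \<pi>)
    \<le> duration pair_instance \<pi>"
proof -
  let ?s = "\<lambda>a b. \<Sum>q\<in>{a..<b}. pos_dist (\<pi> ! q) (\<pi> ! Suc q)"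
  let ?n = "length \<pi> - 1"
  have "set \<pi> \<subseteq> {..<8}"
    using sortie_nodes[OF pair_instance assms(1)] by (simp add: pair_instance_def)
  note path = metric_path_le[OF Metric_space_pos_dist this]
  have "\<pi> \<noteq> []" using assms by auto
  then have "hd \<pi> = \<pi> ! 0" "last \<pi> = \<pi> ! ?n"
    by (auto simp: hd_conv_nth last_conv_nth)
  moreover have "j \<le> ?n" "?n < length \<pi>"
    using assms by auto
  moreover have "duration pair_instance \<pi> = ?s 0 i + ?s i j + ?s j ?n"
    using assms by (simp add: duration_def pair_instance_def lessThan_atLeast0
        sum.atLeastLessThan_concat)
  ultimately show ?thesis
    using path[of 0 i] path[of i j] path[of j ?n] assms by simp
qed

lemma sortie_ends:
  assumes "sortie pair_instance \<pi>"
  shows "hd \<pi> \<in> {0, 1}" "last \<pi> \<in> {0, 1}" "served \<pi> \<subseteq> {2..<8}"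
  using assms by (auto simp: sortie_def pair_instance_def)

lemma duration_ge:
  assumes "sortie pair_instance \<pi>"
  shows "10 \<le> duration pair_instance \<pi>"
proof -
  have len: "3 \<le> length \<pi>"
    using assms by (simp add: sortie_def)
  then have "\<pi> ! 1 \<in> {2..<8}"
    using nth_mem_served[of 1 \<pi>] sortie_ends[OF assms] by auto
  then have "5 \<le> pos_dist (hd \<pi>) (\<pi> ! 1)" "5 \<le> pos_dist (\<pi> ! 1) (last \<pi>)"
    using pos_dist_truck_node sortie_ends[OF assms] by metis+
  then show ?thesis
    using duration_ge_via[OF assms, of 1 1] len
      Metric_space.nonneg[OF Metric_space_pos_dist, of "\<pi> ! 1" "\<pi> ! 1"]
    by linarith
qed

lemma served_two:
  assumes "feasible_sortie pair_instance \<pi>" "x \<in> served \<pi>" "y \<in> served \<pi>" "x \<noteq> y"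
  shows "x div 2 = y div 2" "hd \<pi> \<noteq> last \<pi>"
proof -
  have sortie: "sortie pair_instance \<pi>" and dur: "duration pair_instance \<pi> \<le> 12"
    using assms(1) by (auto simp: feasible_sortie_def energy_def duration_def pair_instance_def)
  note ends = sortie_ends[OF sortie]
  \<comment> \<open>\<open>a\<close> and \<open>b\<close> are \<open>x\<close> and \<open>y\<close>
    in an order in which the sortie visits them; both conclusions are symmetric in \<open>x\<close>
    and \<open>y\<close>.\<close>
  obtain a b where ab: "{a, b} = {x, y}" "a \<in> {2..<8}" "b \<in> {2..<8}" "a \<noteq> b"
    and le: "pos_dist (hd \<pi>) a + pos_dist a b + pos_dist b (last \<pi>) \<le> 12"
  proof -
    obtain i where i: "Suc i < length \<pi>" "\<pi> ! i = x"
      using served_nth[OF assms(2)] by metis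
    obtain j where j: "Suc j < length \<pi>" "\<pi> ! j = y"
      using served_nth[OF assms(3)] by metis
    have "x \<in> {2..<8}" "y \<in> {2..<8}"
      using assms ends by auto
    then show ?thesis
      using that[of x y] that[of y x] duration_ge_via[OF sortie, of i j]
        duration_ge_via[OF sortie, of j i] i j dur assms(4)
      by (cases "i \<le> j") (auto simp: insert_commute)
  qed
  have far: "5 \<le> pos_dist (hd \<pi>) a" "5 \<le> pos_dist b (last \<pi>)"
    using ends ab(2,3) pos_dist_truck_node by metis+
  have same: "a div 2 = b div 2"
    using pos_dist_other_pair[OF ab(2,3)] far le by fastforce
  then show "x div 2 = y div 2"
    using ab(1) by (auto simp: doubleton_eq_iff)
  show "hd \<pi> \<noteq> last \<pi>"
    using pos_dist_same_pair[OF ends(1) ab(2-4) same] le by auto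
qed

lemma card_served_le:
  assumes "feasible_sortie pair_instance \<pi>"
  shows "card (served \<pi>) \<le> (if hd \<pi> = last \<pi> then 1 else 2)"
proof (cases "hd \<pi> = last \<pi>")
  case True
  then show ?thesis
    using served_two(2)[OF assms] by (auto simp: card_le_Suc0_iff_eq served_def)
next
  case False
  \<comment> \<open>The set on the right is the pair that contains \<open>x\<close>.\<close>
  have "served \<pi> \<subseteq> {2 * (x div 2), Suc (2 * (x div 2))}" if "x \<in> served \<pi>" for x
  proof
    fix y assume "y \<in> served \<pi>"
    then have "y div 2 = x div 2"
      using served_two(1)[OF assms] that by metis
    then show "y \<in> {2 * (x div 2), Suc (2 * (x div 2))}"
      by auto
  qed
  then have "card (served \<pi>) \<le> 2"
    using card_mono[of "{2 * (x div 2), Suc (2 * (x div 2))}" "served \<pi>" for x]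
    by (cases "served \<pi> = {}") fastforce+
  then show ?thesis
    using False by simp
qed

section \<open>Solutions of the instance\<close>

lemma truck_route_nth:
  assumes "truck_route pair_instance v" "t < length v"
  shows "v ! t = t mod 2"
  using assms(2)
proof (induction t)
  case 0
  then show ?case
    using assms(1) by (auto simp: truck_route_def hd_conv_nth)
next
  case (Suc t)
  have "v ! t \<noteq> v ! Suc t"
    using assms(1) Suc.prems by (simp add: truck_route_def distinct_adj_conv_nth)
  moreover have "v ! Suc t \<in> {0, 1}"
    using assms(1) nth_mem[OF Suc.prems] by (auto simp: truck_route_def pair_instance_def)
  ultimately show ?case
    using Suc by (auto simp: mod_Suc)
qed

text \<open>The route alternates between 0 and 1, so a fourth visit already repeats the arc from 0
  to 1, at positions 0 and 2.\<close>

lemma length_route_le: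
  assumes "truck_route pair_instance (route S)" "\<not> arc_retraversing S"
  shows "length (route S) \<le> 3"
proof (rule ccontr)
  assume "\<not> ?thesis"
  then have len: "Suc 2 < length (route S)"
    by simp
  have "route S ! t = t mod 2" if "t < 4" for t
    using truck_route_nth[OF assms(1), of t] that len by simp
  from this[of 0] this[of 1] this[of 2] this[of 3]
  have "route S ! 0 = route S ! 2" "route S ! Suc 0 = route S ! Suc 2"
    by simp_all
  then have "arc_retraversing S"
    using len unfolding arc_retraversing_def by (intro exI[of _ 0] exI[of _ 2]) simp
  then show False
    using assms(2) by contradiction
qed

text \<open>Three missions could serve six nodes only as three crossings. Each crossing advances the
  visit index, so the last retrieval would have index at least 3, beyond a route of at most three
  visits.\<close>

lemma length_missions_ge:
  assumes feas: "feasible_solution pair_instance S" and non: "\<not> arc_retraversing S"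
  shows "4 \<le> length (missions S 0)"
proof (rule ccontr)
  define ms where "ms = missions S 0"
  define c where "c k = card (served (flight (ms ! k)))" for k
  define r where "r k = retrieval_visit (ms ! k)" for k
  define l where "l k = launch_visit (ms ! k)" for k
  assume "\<not> ?thesis"
  then have len: "length ms \<le> 3"
    by (simp add: ms_def)
  have route: "truck_route pair_instance (route S)"
    using feas by (simp add: feasible_solution_def)
  have sub: "{2..<8} \<subseteq> (\<Union>k<length ms. served (flight (ms ! k)))"
  proof -
    have "{..<8} \<subseteq> set (route S) \<union> (\<Union>x\<in>set ms. served (flight x))"
      using feas by (simp add: feasible_solution_def pair_instance_def ms_def lessThan_Suc)
    moreover have "set (route S) \<subseteq> {0, 1}"
      using route by (simp add: truck_route_def pair_instance_def)
    ultimately show ?thesis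
      by (fastforce simp: in_set_conv_nth)
  qed
  have "6 \<le> card (\<Union>k<length ms. served (flight (ms ! k)))"
    using card_mono[OF _ sub] by (simp add: served_def)
  also have "\<dots> \<le> (\<Sum>k<length ms. c k)"
    unfolding c_def by (rule card_UN_le) simp
  finally have six: "6 \<le> (\<Sum>k<length ms. c k)" .
  have mission: "feasible_sortie pair_instance (flight (ms ! k))" "l k \<le> r k"
    "r k < length (route S)" "hd (flight (ms ! k)) = route S ! l k"
    "last (flight (ms ! k)) = route S ! r k" if "k < length ms" for k
    using feas that by (auto simp: feasible_solution_def pair_instance_def ms_def l_def r_def)
  \<comment> \<open>Two served nodes force different end nodes, hence different visit
    indices.\<close>
  have c_le: "c k \<le> 2" "c k = 2 \<Longrightarrow> l k < r k" if "k < length ms" for k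
    using card_served_le[OF mission(1)[OF that]] mission(2,4,5)[OF that]
    unfolding c_def by (auto split: if_splits simp: le_less)
  have "(\<Sum>k<length ms. c k) \<le> 2 * length ms"
    using sum_bounded_above[of "{..<length ms}" c 2] c_le by (simp add: mult.commute)
  then have len3: "length ms = 3"
    using six len by simp
  then have "6 \<le> c 0 + c 1 + c 2"
    using six by (simp add: eval_nat_numeral)
  then have "c 0 = 2" "c 1 = 2" "c 2 = 2"
    using c_le(1)[of 0] c_le(1)[of 1] c_le(1)[of 2] len3 by auto
  then have "l 0 < r 0" "l 1 < r 1" "l 2 < r 2"
    using c_le(2) len3 by auto
  moreover have "r k \<le> l (Suc k)" if "Suc k < length ms" for k
    using feas that by (simp add: feasible_solution_def pair_instance_def ms_def l_def r_def)
  from this[of 0] this[of 1] have "r 0 \<le> l 1" "r 1 \<le> l 2"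
    using len3 by (auto simp: numeral_2_eq_2)
  ultimately have "3 \<le> r 2"
    by simp
  then show False
    using mission(3)[of 2] len3 length_route_le[OF route non] by simp
qed

text \<open>At least four sorties of duration at least 10 each share the only drone.\<close>

lemma completion_time_ge:
  assumes "feasible_solution pair_instance S" "\<not> arc_retraversing S"
  shows "40 \<le> completion_time pair_instance S"
proof -
  have "10 \<le> duration pair_instance (flight (missions S 0 ! k))" if "k < length (missions S 0)" for k
    using assms(1) that
    by (intro duration_ge) (auto simp: feasible_solution_def pair_instance_def feasible_sortie_def)
  then have "(\<Sum>k<length (missions S 0). 10) \<le>
      (\<Sum>k<length (missions S 0). duration pair_instance (flight (missions S 0 ! k)))"
    by (intro sum_mono) auto
  also have "\<dots> \<le> completion_time pair_instance S"
    by (intro sum_duration_le_completion_time[OF pair_instance assms(1)])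
      (simp add: pair_instance_def)
  finally show ?thesis
    using length_missions_ge[OF assms] by simp
qed

section \<open>A faster solution with three crossings\<close>

definition three_crossings :: solution where
  "three_crossings = \<lparr>route = [0, 1, 0, 1, 0],
     missions = (\<lambda>_.
       [\<lparr>flight = [0, 2, 3, 1], launch_visit = 0, retrieval_visit = 1\<rparr>,
        \<lparr>flight = [1, 5, 4, 0], launch_visit = 1, retrieval_visit = 2\<rparr>,
        \<lparr>flight = [0, 6, 7, 1], launch_visit = 2, retrieval_visit = 3\<rparr>])\<rparr>"

lemma sqrt_squares: "sqrt 25 = 5" "sqrt 100 = 10"
  by (auto intro: real_sqrt_unique)

text \<open>Each flight meets the node nearer to its start first, so its legs are 5, 2 and
  5.\<close>

lemma duration_three_crossings:
  "duration pair_instance [0, 2, 3, 1] = 12"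
  "duration pair_instance [1, 5, 4, 0] = 12"
  "duration pair_instance [0, 6, 7, 1] = 12"
  by (simp_all add: duration_def pair_instance_def eval_nat_numeral)
    (simp_all add: pos_dist_eq pos_def sqrt_squares)

lemma feasible_three_crossings: "feasible_solution pair_instance three_crossings"
proof -
  have "feasible_sortie pair_instance \<pi>"
    if "\<pi> \<in> {[0, 2, 3, 1], [1, 5, 4, 0], [0, 6, 7, 1]}" for \<pi>
  proof -
    have "energy pair_instance \<pi> = duration pair_instance \<pi>"
      by (simp add: energy_def duration_def pair_instance_def)
    then show ?thesis
      using that duration_three_crossings
      by (auto simp: feasible_sortie_def sortie_def served_def pair_instance_def)
  qed
  moreover have "nodes pair_instance \<subseteq> {0, 1, 2, 3, 4, 5, 6, 7}"
    by (auto simp: pair_instance_def)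
  ultimately show ?thesis
    by (auto simp: feasible_solution_def three_crossings_def truck_route_def served_def
        pair_instance_def less_Suc_eq numeral_2_eq_2)
qed

text \<open>Every crossing takes 12 time units, and the truck leaves one time unit before the drone
  lands on the other side.\<close>

lemma completion_time_three_crossings: "completion_time pair_instance three_crossings \<le> 37"
proof -
  \<comment> \<open>The third retrieval is at time 36 at node 1; the return of the truck to the
    depot adds the last time unit.\<close>
  define \<sigma> where "\<sigma> = \<lparr>arrival = (!) [0, 12, 24, 36, 37], departure = (!) [11, 23, 35, 36, 37],
    launch_time = (\<lambda>_ k. 12 * real k), retrieval_time = (\<lambda>_ k. 12 * real k + 12)\<rparr>"
  have truck: "truck_time pair_instance 0 1 = 1" "truck_time pair_instance 1 0 = 1"
    by (simp_all add: pair_instance_def pos_dist_eq pos_def sqrt_squares)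
  have "num_drones pair_instance = 1"
    by (simp add: pair_instance_def)
  then have "valid_schedule pair_instance three_crossings \<sigma>"
    "completed_by pair_instance three_crossings \<sigma> 37"
    using truck duration_three_crossings
    by (auto simp: valid_schedule_def completed_by_def three_crossings_def \<sigma>_def Let_def less_Suc_eq
        numeral_2_eq_2)
  then show ?thesis
    by (rule completion_time_le[OF pair_instance feasible_three_crossings])
qed

theorem proposition4p1:
  shows "\<exists>I :: tsp_md.
     tsp_md_instance I \<and> (\<exists>S. feasible_solution I S) \<and>
     num_drones I = 1 \<and> (\<forall>i\<in>drone_nodes I. payload I i = 0) \<and> euclidean_metrics I \<and>
     (\<forall>S. optimal_solution I S \<longrightarrow> arc_retraversing S)"
proof (intro exI[of _ pair_instance] conjI allI impI)
  show "\<exists>S. feasible_solution pair_instance S"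
    using feasible_three_crossings by blast
  show "num_drones pair_instance = 1" "\<forall>i\<in>drone_nodes pair_instance. payload pair_instance i = 0"
    by (simp_all add: pair_instance_def)
  fix S
  assume opt: "optimal_solution pair_instance S"
  show "arc_retraversing S"
  proof (rule ccontr)
    assume "\<not> arc_retraversing S"
    \<comment> \<open>The strict gap is 37 < 40.\<close>
    then have "completion_time pair_instance three_crossings < completion_time pair_instance S"
      using completion_time_ge completion_time_three_crossings opt
      by (fastforce simp: optimal_solution_def is_arg_min_def)
    then show False
      using opt feasible_three_crossings by (auto simp: optimal_solution_def is_arg_min_def)
  qed
qed (fact pair_instance euclidean_pair_instance)+

end
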